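(* Let $G$ be a cograph with vertex set $\{1,\ldots,n\}$ and let $\lambda \neq 0$ be a real number. Then there is a matrix $M \in S(G)$ all of whose eigenvalues lie in $\{-\lambda,0,\lambda,2\lambda\}$.
   Context: A cograph is a finite simple graph containing no induced subgraph isomorphic to the path $P_4$ on four vertices. For a simple graph $G$ with vertex set $\{1,\ldots,n\}$ and edge set $E$, $S(G)$ denotes the set of real symmetric $n\times n$ matrices $M=(m_{ij})$ such that for all $i\neq j$, $m_{ij}\neq 0$ if and only if $\{i,j\}\in E$; the diagonal entries are unrestricted. *)

theory Defs
  imports "Jordan_Normal_Form.Char_Poly"
begin

definition simple_graph :: "'a set \<Rightarrow> 'a set set \<Rightarrow> bool" where
  "simple_graph V E \<longleftrightarrow> finite V \<and> (\<forall>e\<in>E. e \<subseteq> V \<and> card e = 2)"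

definition induced_edges :: "'a set set \<Rightarrow> 'a set \<Rightarrow> 'a set set" where
  "induced_edges E W = {e \<in> E. e \<subseteq> W}"

definition graph_isomorphic ::
  "'a set \<Rightarrow> 'a set set \<Rightarrow> 'b set \<Rightarrow> 'b set set \<Rightarrow> bool" where
  "graph_isomorphic V E W F \<longleftrightarrow>
     (\<exists>f. bij_betw f V W \<and> (\<forall>u\<in>V. \<forall>v\<in>V. {u, v} \<in> E \<longleftrightarrow> {f u, f v} \<in> F))"

definition path_edges :: "nat \<Rightarrow> nat set set" where
  "path_edges k = {{i, Suc i} | i. Suc i < k}"

text \<open>The path on \<open>k\<close> vertices is \<open>({..<k}, path_edges k)\<close>.\<close>

definition cograph :: "'a set \<Rightarrow> 'a set set \<Rightarrow> bool" where
  "cograph V E \<longleftrightarrow> simple_graph V E \<and>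
     \<not> (\<exists>W\<subseteq>V. graph_isomorphic W (induced_edges E W) {..<4} (path_edges 4))"

text \<open>Vertices are \<open>1, \<dots>, n\<close>, whereas the rows and columns of a matrix are numbered from \<open>0\<close>:
  the entry \<open>m\<^sub>i\<^sub>j\<close> is \<open>M $$ (i - 1, j - 1)\<close>.\<close>

definition graph_matrices :: "nat \<Rightarrow> nat set set \<Rightarrow> real mat set" where
  "graph_matrices n E =
     {M \<in> carrier_mat n n. transpose_mat M = M \<and>
        (\<forall>i\<in>{1..n}. \<forall>j\<in>{1..n}. i \<noteq> j \<longrightarrow> (M $$ (i - 1, j - 1) \<noteq> 0 \<longleftrightarrow> {i, j} \<in> E))}"

end

theory Submission
  imports Defs
begin

text \<open>
  Scale to \<open>\<lambda> = 1\<close>. By induction on the decomposition of a cograph into unions and joins, it has for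
  both \<open>a = 0\<close> and \<open>a = 1\<close> a matrix with spectrum in \<open>{-1, 0, 1, 2}\<close> and a nowhere-zero eigenvector
  for \<open>a\<close>. For a union, take the block diagonal matrix. For a join, let \<open>M\<^sub>1 u = a u\<close> and \<open>M\<^sub>2 v = a v\<close>
  with \<open>u\<close> and \<open>v\<close> of norm 1, and fill the off-diagonal blocks with \<open>u v\<^sup>T\<close> and \<open>v u\<^sup>T\<close>. This
  replaces the two eigenvalues \<open>a\<close> by \<open>a + 1\<close> and \<open>a - 1\<close>, whose eigenvectors \<open>(u, v)\<close> and \<open>(u, -v)\<close>
  are nowhere zero, so that \<open>a = 0\<close> for the parts yields \<open>1\<close> for the join and \<open>a = 1\<close> yields \<open>0\<close>.
\<close>

section \<open>Splitting graphs without induced four-vertex paths\<close>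

definition P4_free :: "'a set \<Rightarrow> ('a \<Rightarrow> 'a \<Rightarrow> bool) \<Rightarrow> bool" where
  "P4_free V R \<longleftrightarrow> (\<forall>a\<in>V. \<forall>b\<in>V. \<forall>c\<in>V. \<forall>d\<in>V. distinct [a, b, c, d] \<longrightarrow>
     \<not> (R a b \<and> R b c \<and> R c d \<and> \<not> R a c \<and> \<not> R b d \<and> \<not> R a d))"

text \<open>The two alternatives are join and disjoint union. Keeping both in one predicate makes it
  invariant under complementation.\<close>

definition homogeneous_split :: "'a set \<Rightarrow> ('a \<Rightarrow> 'a \<Rightarrow> bool) \<Rightarrow> 'a set \<Rightarrow> 'a set \<Rightarrow> bool" where
  "homogeneous_split V R A B \<longleftrightarrow> A \<noteq> {} \<and> B \<noteq> {} \<and> A \<inter> B = {} \<and> A \<union> B = V \<and>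
     ((\<forall>x\<in>A. \<forall>y\<in>B. R x y) \<or> (\<forall>x\<in>A. \<forall>y\<in>B. \<not> R x y))"

lemma P4_free_subset: "P4_free V R \<Longrightarrow> W \<subseteq> V \<Longrightarrow> P4_free W R"
  unfolding P4_free_def by blast

text \<open>The four-vertex path is self-complementary: the complement of the path
  \<open>a b c d\<close> is the path \<open>b d a c\<close>. The negated relation is reflexive where
  \<open>R\<close> is not, but only distinct vertices are tested.\<close>

lemma P4_free_complement:
  assumes "symp R" "P4_free V R"
  shows "P4_free V (\<lambda>x y. \<not> R x y)"
  unfolding P4_free_def
proof (intro ballI impI notI)
  fix a b c d
  assume abcd: "a \<in> V" "b \<in> V" "c \<in> V" "d \<in> V" "distinct [a, b, c, d]"
    and p: "\<not> R a b \<and> \<not> R b c \<and> \<not> R c d \<and> \<not> \<not> R a c \<and> \<not> \<not> R b d \<and> \<not> \<not> R a d"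
  have "distinct [b, d, a, c]" using abcd by auto
  moreover have "R b d \<and> R d a \<and> R a c \<and> \<not> R b a \<and> \<not> R d c \<and> \<not> R b c"
    using p assms(1) by (meson sympD)
  ultimately show False using assms(2) abcd unfolding P4_free_def by blast
qed

lemma homogeneous_split_complement:
  "homogeneous_split V (\<lambda>x y. \<not> R x y) A B \<longleftrightarrow> homogeneous_split V R A B"
  unfolding homogeneous_split_def by auto

text \<open>If \<open>v\<close> has a neighbour \<open>y\<close> in \<open>B\<close>, an edge \<open>z x\<close> of \<open>A\<close> with \<open>x\<close> but not \<open>z\<close> adjacent to \<open>v\<close>
  would complete an induced path \<open>z x v y\<close>; so the non-neighbours of \<open>v\<close> in \<open>A\<close> split off.\<close>

lemma split_insert_nonneighbour:
  assumes R: "symp R" and free: "P4_free (insert v (A \<union> B)) R"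
    and v: "v \<notin> A \<union> B" and AB: "B \<noteq> {}" "A \<inter> B = {}"
    and none: "\<forall>x\<in>A. \<forall>y\<in>B. \<not> R x y"
    and w: "w \<in> A" "\<not> R v w"
  shows "\<exists>C D. homogeneous_split (insert v (A \<union> B)) R C D"
proof (cases "\<exists>y\<in>B. R v y")
  case False
  have "homogeneous_split (insert v (A \<union> B)) R (insert v A) B"
    unfolding homogeneous_split_def using False none AB v by auto
  then show ?thesis by blast
next
  case True
  then obtain y where y: "y \<in> B" "R v y" by blast
  define C where "C = {z \<in> A. \<not> R v z}"
  have "\<not> R z x" if "z \<in> C" "x \<in> A" "x \<notin> C" for z x
  proof
    assume zx: "R z x"
    have z: "z \<in> A" "\<not> R z v" and x: "R x v"
      using that R unfolding C_def by (auto dest: sympD)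
    have "distinct [z, x, v, y]" using that z y v AB by auto
    moreover have "\<not> R x y" "\<not> R z y" using none that z y by auto
    ultimately show False
      using free z x y zx that unfolding P4_free_def by blast
  qed
  moreover have "\<not> R z v" if "z \<in> C" for z
    using that R unfolding C_def by (auto dest: sympD)
  moreover have "\<not> R z b" if "z \<in> C" "b \<in> B" for z b
    using that none unfolding C_def by auto
  moreover have "C \<subseteq> A" "w \<in> C" unfolding C_def using w by auto
  ultimately have "homogeneous_split (insert v (A \<union> B)) R C (insert v (A \<union> B) - C)"
    unfolding homogeneous_split_def using v by auto
  then show ?thesis by blast
qed

text \<open>If \<open>v\<close> is adjacent to everything, it splits off alone as a join. Otherwise
  it misses a vertex of one part, and the situation is symmetric in \<open>A\<close> and
  \<open>B\<close>.\<close>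

lemma split_insert_of_no_edges:
  assumes R: "symp R" and free: "P4_free (insert v (A \<union> B)) R"
    and v: "v \<notin> A \<union> B" and AB: "A \<noteq> {}" "B \<noteq> {}" "A \<inter> B = {}"
    and none: "\<forall>x\<in>A. \<forall>y\<in>B. \<not> R x y"
  shows "\<exists>C D. homogeneous_split (insert v (A \<union> B)) R C D"
proof (cases "\<forall>w\<in>A \<union> B. R v w")
  case True
  then have "homogeneous_split (insert v (A \<union> B)) R {v} (A \<union> B)"
    unfolding homogeneous_split_def using v AB by auto
  then show ?thesis by blast
next
  case False
  then obtain w where w: "w \<in> A \<union> B" "\<not> R v w" by blast
  show ?thesis
  proof (cases "w \<in> A")
    case True
    show ?thesis by (rule split_insert_nonneighbour[OF R free v AB(2,3) none True w(2)])
  next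
    case False
    then have wB: "w \<in> B" using w by blast
    have none': "\<forall>x\<in>B. \<forall>y\<in>A. \<not> R x y" using none R by (meson sympD)
    have "B \<inter> A = {}" using AB by blast
    from split_insert_nonneighbour[OF R _ _ AB(1) this none' wB w(2)] show ?thesis
      using free v by (simp add: Un_commute)
  qed
qed

text \<open>Seinsche's theorem, by adding one vertex at a time. The smaller set splits as a union or
  a join; the insertion step is proved for unions only.\<close>

lemma P4_free_split:
  assumes "finite V" "symp R" "P4_free V R" "card V \<ge> 2"
  shows "\<exists>A B. homogeneous_split V R A B"
  using assms
proof (induction V rule: finite_induct)
  case empty
  then show ?case by simp
next
  case (insert v V)
  show ?case
  proof (cases "card V \<ge> 2")
    case False
    then have "card V = 1" using insert by simp
    then obtain w where V: "V = {w}" by (auto simp: card_1_singleton_iff)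
    then have "homogeneous_split (insert v V) R {v} {w}"
      unfolding homogeneous_split_def using insert by auto
    then show ?thesis by blast
  next
    case True
    have "P4_free V R" using insert.prems(2) by (rule P4_free_subset) blast
    with insert True obtain A B where AB: "homogeneous_split V R A B" by blast
    then have V: "V = A \<union> B" "A \<noteq> {}" "B \<noteq> {}" "A \<inter> B = {}"
      unfolding homogeneous_split_def by auto
    have v: "v \<notin> A \<union> B" using insert V by blast
    show ?thesis
    proof (cases "\<forall>x\<in>A. \<forall>y\<in>B. \<not> R x y")
      case True
      show ?thesis
        using split_insert_of_no_edges[OF insert.prems(1) _ v V(2-4) True] insert.prems V(1) by simp
    next
      \<comment> \<open>A join is a union in the complement, which is again free of induced
        four-vertex paths.\<close>
      case False
      with AB have "\<forall>x\<in>A. \<forall>y\<in>B. \<not> \<not> R x y" unfolding homogeneous_split_def by auto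
      moreover have "symp (\<lambda>x y. \<not> R x y)"
        using insert.prems(1) by (auto intro!: sympI dest: sympD)
      ultimately show ?thesis
        using split_insert_of_no_edges[of "\<lambda>x y. \<not> R x y", OF _ _ v V(2-4)]
          P4_free_complement[OF insert.prems(1,2)] V(1)
        by (simp add: homogeneous_split_complement)
    qed
  qed
qed

section \<open>Gluing matrices along eigenvectors\<close>

text \<open>Matrices are functions on an arbitrary vertex set, so blocks can be glued without
  reindexing. The last clause confines the spectrum on \<open>V\<close> to \<open>S\<close>; real
  \<open>\<mu>\<close> suffice by symmetry.\<close>

definition pattern_with_eigenvector ::
  "real set \<Rightarrow> 'a set \<Rightarrow> ('a \<Rightarrow> 'a \<Rightarrow> bool) \<Rightarrow> real \<Rightarrow> ('a \<Rightarrow> 'a \<Rightarrow> real) \<Rightarrow> ('a \<Rightarrow> real) \<Rightarrow> bool" where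
  "pattern_with_eigenvector S V R a m u \<longleftrightarrow>
     (\<forall>i\<in>V. \<forall>j\<in>V. m i j = m j i) \<and>
     (\<forall>i\<in>V. \<forall>j\<in>V. i \<noteq> j \<longrightarrow> (m i j \<noteq> 0 \<longleftrightarrow> R i j)) \<and>
     (\<forall>i\<in>V. u i \<noteq> 0) \<and>
     (\<forall>i\<in>V. (\<Sum>j\<in>V. m i j * u j) = a * u i) \<and>
     (\<forall>\<mu> x. (\<forall>i\<in>V. (\<Sum>j\<in>V. m i j * x j) = \<mu> * x i) \<longrightarrow> (\<exists>i\<in>V. x i \<noteq> 0) \<longrightarrow> \<mu> \<in> S)"

lemma pattern_with_eigenvector_normalize:
  assumes "pattern_with_eigenvector S V R a m u" "finite V" "V \<noteq> {}"
  obtains w where "pattern_with_eigenvector S V R a m w" "(\<Sum>i\<in>V. w i * w i) = 1"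
proof -
  define N where "N = (\<Sum>i\<in>V. u i * u i)"
  have u: "\<forall>i\<in>V. u i \<noteq> 0" "\<forall>i\<in>V. (\<Sum>j\<in>V. m i j * u j) = a * u i"
    using assms(1) unfolding pattern_with_eigenvector_def by auto
  have N: "N > 0" unfolding N_def
    using assms u by (intro sum_pos) (auto simp: zero_less_mult_iff linorder_neq_iff)
  have "pattern_with_eigenvector S V R a m (\<lambda>i. u i / sqrt N)"
    using assms(1) u N unfolding pattern_with_eigenvector_def
    by (simp flip: sum_divide_distrib)
  moreover have "(\<Sum>i\<in>V. u i / sqrt N * (u i / sqrt N)) = 1"
    using N by (simp add: N_def[symmetric] flip: sum_divide_distrib)
  ultimately show ?thesis by (rule that)
qed

lemma sum_symmetric_eigenvector:
  fixes m :: "'a \<Rightarrow> 'a \<Rightarrow> 'b::comm_ring"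
  assumes "\<forall>i\<in>V. \<forall>j\<in>V. m i j = m j i" "\<forall>i\<in>V. (\<Sum>j\<in>V. m i j * u j) = a * u i"
  shows "(\<Sum>i\<in>V. u i * (\<Sum>j\<in>V. m i j * x j)) = a * (\<Sum>j\<in>V. u j * x j)"
proof -
  have "(\<Sum>i\<in>V. u i * (\<Sum>j\<in>V. m i j * x j)) = (\<Sum>i\<in>V. \<Sum>j\<in>V. m i j * u i * x j)"
    by (simp add: sum_distrib_left mult_ac)
  also have "\<dots> = (\<Sum>j\<in>V. \<Sum>i\<in>V. m i j * u i * x j)" by (rule sum.swap)
  also have "\<dots> = (\<Sum>j\<in>V. (\<Sum>i\<in>V. m j i * u i) * x j)"
    using assms(1) by (auto simp: sum_distrib_right intro!: sum.cong)
  also have "\<dots> = a * (\<Sum>j\<in>V. u j * x j)"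
    using assms(2) by (simp add: sum_distrib_left mult_ac)
  finally show ?thesis .
qed

text \<open>Pairing the perturbed eigenvalue equation with the unit vector \<open>u\<close> and
  moving \<open>m\<close> onto \<open>u\<close> leaves a scalar equation for the coordinate of
  \<open>x\<close> along \<open>u\<close>.\<close>

lemma rank_one_row_projection:
  fixes m :: "'a \<Rightarrow> 'a \<Rightarrow> real"
  assumes "\<forall>i\<in>V. \<forall>j\<in>V. m i j = m j i" "\<forall>i\<in>V. (\<Sum>j\<in>V. m i j * u j) = a * u i"
    and "(\<Sum>i\<in>V. u i * u i) = 1"
    and row: "\<forall>i\<in>V. (\<Sum>j\<in>V. m i j * x j) + u i * c = \<mu> * x i"
  shows "a * (\<Sum>i\<in>V. u i * x i) + c = \<mu> * (\<Sum>i\<in>V. u i * x i)"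
proof -
  have "\<mu> * (\<Sum>i\<in>V. u i * x i) = (\<Sum>i\<in>V. u i * ((\<Sum>j\<in>V. m i j * x j) + u i * c))"
    using row by (simp add: sum_distrib_left mult_ac)
  also have "\<dots> = (\<Sum>i\<in>V. u i * (\<Sum>j\<in>V. m i j * x j)) + (\<Sum>i\<in>V. u i * u i) * c"
    by (simp add: distrib_left sum.distrib sum_distrib_right mult.assoc)
  also have "\<dots> = a * (\<Sum>i\<in>V. u i * x i) + c"
    using sum_symmetric_eigenvector[OF assms(1,2)] assms(3) by simp
  finally show ?thesis ..
qed

text \<open>Here \<open>t = 0\<close> gives a union and \<open>t \<noteq> 0\<close> a join with
  off-diagonal block \<open>t u v^T\<close>. On the span of \<open>(u, 0)\<close> and
  \<open>(0, v)\<close> the glued matrix acts as the 2 by 2 matrix with diagonal \<open>a\<close>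
  and off-diagonal \<open>t\<close>. The sign \<open>s\<close> selects which of its eigenvectors
  \<open>(u, s v)\<close> is passed on.\<close>

lemma pattern_with_eigenvector_glue:
  assumes split: "A \<inter> B = {}" and fin: "finite A" "finite B"
    and R: "symp R" "\<forall>x\<in>A. \<forall>y\<in>B. R x y \<longleftrightarrow> t \<noteq> 0"
    and S: "a + t \<in> S" "a - t \<in> S" and s: "s = 1 \<or> s = -1"
    and A: "pattern_with_eigenvector S A R a m1 u" "(\<Sum>i\<in>A. u i * u i) = 1"
    and B: "pattern_with_eigenvector S B R a m2 v" "(\<Sum>i\<in>B. v i * v i) = 1"
  shows "\<exists>m w. pattern_with_eigenvector S (A \<union> B) R (a + s * t) m w"
proof -
  define m where "m = (\<lambda>i j. if i \<in> A then if j \<in> A then m1 i j else t * u i * v j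
                         else if j \<in> A then t * v i * u j else m2 i j)"
  define w where "w = (\<lambda>i. if i \<in> A then u i else s * v i)"
  \<comment> \<open>On \<open>B\<close> the eigenvector equation reads
    \<open>s a v + t v = (a + s t) s v\<close>, which rests on \<open>s * s = 1\<close>.\<close>
  have s_sq: "s * s = 1" "s \<noteq> 0" using s by auto
  have notA: "i \<notin> A" if "i \<in> B" for i using split that by blast
  have A': "\<forall>i\<in>A. \<forall>j\<in>A. m1 i j = m1 j i" "\<forall>i\<in>A. (\<Sum>j\<in>A. m1 i j * u j) = a * u i"
      "\<forall>i\<in>A. \<forall>j\<in>A. i \<noteq> j \<longrightarrow> (m1 i j \<noteq> 0 \<longleftrightarrow> R i j)" "\<forall>i\<in>A. u i \<noteq> 0"
      "\<And>\<mu> x. (\<forall>i\<in>A. (\<Sum>j\<in>A. m1 i j * x j) = \<mu> * x i) \<Longrightarrow> (\<exists>i\<in>A. x i \<noteq> 0) \<Longrightarrow> \<mu> \<in> S"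
    using A(1) unfolding pattern_with_eigenvector_def by auto
  have B': "\<forall>i\<in>B. \<forall>j\<in>B. m2 i j = m2 j i" "\<forall>i\<in>B. (\<Sum>j\<in>B. m2 i j * v j) = a * v i"
      "\<forall>i\<in>B. \<forall>j\<in>B. i \<noteq> j \<longrightarrow> (m2 i j \<noteq> 0 \<longleftrightarrow> R i j)" "\<forall>i\<in>B. v i \<noteq> 0"
      "\<And>\<mu> x. (\<forall>i\<in>B. (\<Sum>j\<in>B. m2 i j * x j) = \<mu> * x i) \<Longrightarrow> (\<exists>i\<in>B. x i \<noteq> 0) \<Longrightarrow> \<mu> \<in> S"
    using B(1) unfolding pattern_with_eigenvector_def by auto
  have rowA: "(\<Sum>j\<in>A \<union> B. m i j * x j) =
      (\<Sum>j\<in>A. m1 i j * x j) + u i * (t * (\<Sum>j\<in>B. v j * x j))" if "i \<in> A" for i x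
  proof -
    have "(\<Sum>j\<in>A \<union> B. m i j * x j) = (\<Sum>j\<in>A. m i j * x j) + (\<Sum>j\<in>B. m i j * x j)"
      using fin split by (rule sum.union_disjoint)
    then show ?thesis
      using that notA by (simp add: m_def sum_distrib_left mult_ac cong: sum.cong)
  qed
  have rowB: "(\<Sum>j\<in>A \<union> B. m i j * x j) =
      (\<Sum>j\<in>B. m2 i j * x j) + v i * (t * (\<Sum>j\<in>A. u j * x j))" if "i \<in> B" for i x
  proof -
    have "(\<Sum>j\<in>A \<union> B. m i j * x j) = (\<Sum>j\<in>A. m i j * x j) + (\<Sum>j\<in>B. m i j * x j)"
      using fin split by (rule sum.union_disjoint)
    then show ?thesis
      using that notA by (simp add: m_def sum_distrib_left mult_ac cong: sum.cong)
  qed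
  have sym: "\<forall>i\<in>A \<union> B. \<forall>j\<in>A \<union> B. m i j = m j i"
    using A'(1) B'(1) notA by (auto simp: m_def)
  have "\<forall>x\<in>A. \<forall>y\<in>B. R y x \<longleftrightarrow> t \<noteq> 0" using R by (meson sympD)
  then have pattern: "\<forall>i\<in>A \<union> B. \<forall>j\<in>A \<union> B. i \<noteq> j \<longrightarrow> (m i j \<noteq> 0 \<longleftrightarrow> R i j)"
    using A'(3,4) B'(3,4) R(2) notA by (auto simp: m_def)
  have nonzero: "\<forall>i\<in>A \<union> B. w i \<noteq> 0"
    using A'(4) B'(4) s_sq notA by (auto simp: w_def)
  have wA: "(\<Sum>j\<in>A. f j * w j) = (\<Sum>j\<in>A. f j * u j)" for f
    by (simp add: w_def cong: sum.cong)
  have wB: "(\<Sum>j\<in>B. f j * w j) = s * (\<Sum>j\<in>B. f j * v j)" for f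
    using notA by (simp add: w_def sum_distrib_left mult_ac cong: sum.cong)
  have eigenvector: "\<forall>i\<in>A \<union> B. (\<Sum>j\<in>A \<union> B. m i j * w j) = (a + s * t) * w i"
  proof
    fix i assume "i \<in> A \<union> B"
    then consider "i \<in> A" | "i \<in> B" by blast
    then show "(\<Sum>j\<in>A \<union> B. m i j * w j) = (a + s * t) * w i"
    proof cases
      case 1
      then show ?thesis
        using A'(2) B(2) by (simp add: rowA wA wB) (simp add: w_def algebra_simps)
    next
      case 2
      then show ?thesis
        using B'(2) A(2) notA[OF 2] s_sq by (simp add: rowB wA wB) (simp add: w_def algebra_simps)
    qed
  qed
  have spectrum: "\<mu> \<in> S"
    if x: "\<forall>i\<in>A \<union> B. (\<Sum>j\<in>A \<union> B. m i j * x j) = \<mu> * x i" and nz: "\<exists>i\<in>A \<union> B. x i \<noteq> 0" for \<mu> x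
  proof (cases "\<mu> = a + t \<or> \<mu> = a - t")
    case True
    then show ?thesis using S by auto
  next
    case False
    define p where "p = (\<Sum>i\<in>A. u i * x i)"
    define q where "q = (\<Sum>i\<in>B. v i * x i)"
    have xA: "\<forall>i\<in>A. (\<Sum>j\<in>A. m1 i j * x j) + u i * (t * q) = \<mu> * x i"
      using x by (simp add: rowA[symmetric] q_def)
    have xB: "\<forall>i\<in>B. (\<Sum>j\<in>B. m2 i j * x j) + v i * (t * p) = \<mu> * x i"
      using x by (simp add: rowB[symmetric] p_def)
    \<comment> \<open>So \<open>(p, q)\<close> satisfies the eigenvalue equation of the 2 by 2
      matrix for a \<open>\<mu>\<close> that is not one of its eigenvalues \<open>a + t\<close> and
      \<open>a - t\<close>; hence it vanishes.\<close>
    have pq: "a * p + t * q = \<mu> * p" "a * q + t * p = \<mu> * q"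
      using rank_one_row_projection[OF A'(1,2) A(2) xA]
        rank_one_row_projection[OF B'(1,2) B(2) xB] by (auto simp: p_def q_def)
    have "(a + t - \<mu>) * (p + q) = 0" "(a - t - \<mu>) * (p - q) = 0"
      using pq by (auto simp: algebra_simps)
    with False have "p + q = 0" "p - q = 0" by auto
    then have "p = 0" "q = 0" by auto
    \<comment> \<open>Without the rank-one terms, \<open>x\<close> restricted to a part where it is
      nonzero is an eigenvector of that part's matrix.\<close>
    with xA xB A'(5)[of x \<mu>] B'(5)[of x \<mu>] nz show ?thesis by auto
  qed
  have "pattern_with_eigenvector S (A \<union> B) R (a + s * t) m w"
    unfolding pattern_with_eigenvector_def
    by (intro conjI sym pattern nonzero eigenvector allI impI) (rule spectrum)
  then show ?thesis by blast
qed

lemma P4_free_pattern_with_eigenvector: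
  assumes "finite V" "V \<noteq> {}" "symp R" "P4_free V R" "a = 0 \<or> a = 1"
  shows "\<exists>m u. pattern_with_eigenvector {-1, 0, 1, 2} V R a m u"
  using assms
\<comment> \<open>\<open>a\<close> must vary: a join for one value uses its parts with the
  other.\<close>
proof (induction "card V" arbitrary: V a rule: less_induct)
  case less
  let ?S = "{-1, 0, 1, 2} :: real set"
  show ?case
  proof (cases "card V \<ge> 2")
    case False
    then have "card V = 1" using less.prems(1,2) card_gt_0_iff[of V] by linarith
    then obtain v where V: "V = {v}" by (auto simp: card_1_singleton_iff)
    have "pattern_with_eigenvector ?S V R a (\<lambda>i j. a) (\<lambda>i. 1)"
      unfolding pattern_with_eigenvector_def V using less.prems(5) by auto
    then show ?thesis by blast
  next
    case True
    then obtain A B where "homogeneous_split V R A B"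
      using P4_free_split less.prems by blast
    then have AB: "A \<noteq> {}" "B \<noteq> {}" "A \<inter> B = {}" "V = A \<union> B"
      and R: "(\<forall>x\<in>A. \<forall>y\<in>B. R x y) \<or> (\<forall>x\<in>A. \<forall>y\<in>B. \<not> R x y)"
      unfolding homogeneous_split_def by auto
    have fin: "finite A" "finite B" using AB less.prems by auto
    have part: "\<exists>m u. pattern_with_eigenvector ?S W R b m u \<and> (\<Sum>i\<in>W. u i * u i) = 1"
      if W: "W = A \<or> W = B" and b: "b = 0 \<or> b = 1" for W b
    proof -
      have "W \<subset> V" "W \<noteq> {}" using W AB by auto
      then have "card W < card V" "finite W" "P4_free W R"
        using less.prems by (auto intro: psubset_card_mono finite_subset P4_free_subset)
      then obtain m u where "pattern_with_eigenvector ?S W R b m u"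
        using less.hyps[of W b] less.prems(3) \<open>W \<noteq> {}\<close> b by blast
      from pattern_with_eigenvector_normalize[OF this \<open>finite W\<close> \<open>W \<noteq> {}\<close>] show ?thesis
        by blast
    qed
    have glue: "\<exists>m w. pattern_with_eigenvector ?S V R (b + s * t) m w"
      if b: "b = 0 \<or> b = 1" and "\<forall>x\<in>A. \<forall>y\<in>B. R x y \<longleftrightarrow> t \<noteq> 0"
        and "b + t \<in> ?S" "b - t \<in> ?S" "s = 1 \<or> s = -1" for b s t
    proof -
      obtain m1 u m2 v where
        "pattern_with_eigenvector ?S A R b m1 u" "(\<Sum>i\<in>A. u i * u i) = 1"
        "pattern_with_eigenvector ?S B R b m2 v" "(\<Sum>i\<in>B. v i * v i) = 1"
        using part[OF _ b, of A] part[OF _ b, of B] by blast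
      from pattern_with_eigenvector_glue[OF AB(3) fin less.prems(3) that(2-5) this]
      show ?thesis using AB(4) by simp
    qed
    from R show ?thesis
    proof
      assume "\<forall>x\<in>A. \<forall>y\<in>B. \<not> R x y"
      \<comment> \<open>The instances are in the order \<open>b\<close>, \<open>t\<close>,
        \<open>s\<close>; for a union, \<open>t = 0\<close> keeps \<open>a\<close>.\<close>
      then show ?thesis using glue[of a 0 1] less.prems(5) by auto
    next
      assume "\<forall>x\<in>A. \<forall>y\<in>B. R x y"
      \<comment> \<open>Parts with \<open>b = 1\<close> create the eigenvalues 2 and 0, and
        \<open>s = -1\<close> picks 0. Parts with \<open>b = 0\<close> create 1 and -1, and
        \<open>s = 1\<close> picks 1.\<close>
      then show ?thesis using glue[of 1 1 "-1"] glue[of 0 1 1] less.prems(5) by auto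
    qed
  qed
qed

section \<open>Cographs\<close>

lemma path_edges_4: "path_edges 4 = {{0, 1}, {1, 2}, {2, 3}}"
proof -
  have "Suc i < 4 \<longleftrightarrow> i = 0 \<or> i = 1 \<or> i = 2" for i by auto
  then show ?thesis unfolding path_edges_def by (auto simp: numeral_eq_Suc)
qed

lemma cograph_P4_free:
  assumes "cograph V E"
  shows "P4_free V (\<lambda>x y. {x, y} \<in> E)"
  unfolding P4_free_def
proof (intro ballI impI notI)
  fix a b c d
  assume V: "a \<in> V" "b \<in> V" "c \<in> V" "d \<in> V" and dist: "distinct [a, b, c, d]"
    and p: "{a, b} \<in> E \<and> {b, c} \<in> E \<and> {c, d} \<in> E \<and> {a, c} \<notin> E \<and> {b, d} \<notin> E \<and> {a, d} \<notin> E"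
  define W where "W = {a, b, c, d}"
  define f :: "'a \<Rightarrow> nat" where "f = (\<lambda>x. if x = a then 0 else if x = b then 1 else if x = c then 2 else 3)"
  have f: "f a = 0" "f b = 1" "f c = 2" "f d = 3" using dist by (auto simp: f_def)
  have "{..<4::nat} = {0, 1, 2, 3}" by auto
  then have "bij_betw f W {..<4}"
    unfolding bij_betw_def W_def inj_on_def using f by auto
  \<comment> \<open>\<open>graph_isomorphic\<close> also compares the pairs with
    \<open>x = y\<close>, so loops must be excluded.\<close>
  moreover have loop: "{x} \<notin> E" for x
    using assms unfolding cograph_def simple_graph_def by fastforce
  have "{x, y} \<in> induced_edges E W \<longleftrightarrow> {f x, f y} \<in> path_edges 4" if "x \<in> W" "y \<in> W" for x y
  proof -
    have "{x, y} \<in> induced_edges E W \<longleftrightarrow> {x, y} \<in> E" using that by (simp add: induced_edges_def)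
    moreover have "{x, y} \<in> E \<longleftrightarrow> {f x, f y} \<in> path_edges 4"
      using that p loop unfolding W_def path_edges_4
      by (elim insertE emptyE) (auto simp: f doubleton_eq_iff insert_commute)
    ultimately show ?thesis by simp
  qed
  ultimately have "graph_isomorphic W (induced_edges E W) {..<4} (path_edges 4)"
    unfolding graph_isomorphic_def by blast
  moreover have "W \<subseteq> V" unfolding W_def using V by blast
  ultimately show False using assms unfolding cograph_def by blast
qed

theorem theorem1p2:
  fixes n :: nat and E :: "nat set set" and lam :: real
  assumes "cograph {1..n} E" and "lam \<noteq> 0"
  shows "\<exists>M \<in> graph_matrices n E. \<forall>\<mu>. eigenvalue M \<mu> \<longrightarrow> \<mu> \<in> {- lam, 0, lam, 2 * lam}"
\<comment> \<open>The induction covers nonempty vertex sets only. In dimension 0 every vector is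
  zero, so there are no eigenvalues.\<close>
proof (cases "n = 0")
  case True
  have "0\<^sub>m 0 0 \<in> graph_matrices n E" using True by (simp add: graph_matrices_def)
  moreover have "\<not> eigenvalue (0\<^sub>m 0 0 :: real mat) \<mu>" for \<mu>
    by (auto simp: eigenvalue_def eigenvector_def)
  ultimately show ?thesis by blast
next
  case False
  let ?V = "{1..n}" and ?R = "\<lambda>x y. {x, y} \<in> E"
  have "symp ?R" by (auto intro!: sympI simp: insert_commute)
  then obtain m u where mu: "pattern_with_eigenvector {-1, 0, 1, 2} ?V ?R 0 m u"
    using P4_free_pattern_with_eigenvector[of ?V ?R 0] cograph_P4_free[OF assms(1)] False by auto
  then have spectrum: "\<mu> \<in> {-1, 0, 1, 2}"
    if "\<forall>i\<in>?V. (\<Sum>j\<in>?V. m i j * x j) = \<mu> * x i" "\<exists>i\<in>?V. x i \<noteq> 0" for x \<mu>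
    using that unfolding pattern_with_eigenvector_def by simp
  define M where "M = mat n n (\<lambda>(i, j). lam * m (Suc i) (Suc j))"
  have carrier: "M \<in> carrier_mat n n" by (simp add: M_def)
  have "transpose_mat M = M"
    using mu unfolding pattern_with_eigenvector_def by (intro eq_matI) (auto simp: M_def)
  moreover have "M $$ (i - 1, j - 1) = lam * m i j" if "i \<in> ?V" "j \<in> ?V" for i j
    using that by (auto simp: M_def)
  ultimately have "M \<in> graph_matrices n E"
    using carrier mu assms(2) unfolding graph_matrices_def pattern_with_eigenvector_def by auto
  moreover have "\<mu> \<in> {- lam, 0, lam, 2 * lam}" if "eigenvalue M \<mu>" for \<mu>
  proof -
    from that obtain x where x: "x \<in> carrier_vec n" "x \<noteq> 0\<^sub>v n" "M *\<^sub>v x = \<mu> \<cdot>\<^sub>v x"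
      using carrier unfolding eigenvalue_def eigenvector_def by auto
    \<comment> \<open>Undoing the scaling and the index shift turns \<open>x\<close> into an
      eigenvector of \<open>m\<close> for \<open>\<mu> / lam\<close>.\<close>
    have "(\<Sum>j\<in>?V. m i j * x $ (j - 1)) = \<mu> / lam * x $ (i - 1)" if "i \<in> ?V" for i
    proof -
      have i: "i - 1 < n" "Suc (i - 1) = i" using that by auto
      have "\<mu> * x $ (i - 1) = (M *\<^sub>v x) $ (i - 1)" using x i by simp
      also have "\<dots> = (\<Sum>j<n. lam * m i (Suc j) * x $ j)"
        using x(1) i by (simp add: M_def scalar_prod_def atLeast0LessThan)
      also have "\<dots> = (\<Sum>j\<in>?V. lam * m i j * x $ (j - 1))"
        by (rule sum.reindex_bij_witness[of _ "\<lambda>j. j - 1" Suc]) auto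
      also have "\<dots> = lam * (\<Sum>j\<in>?V. m i j * x $ (j - 1))"
        by (simp add: sum_distrib_left mult_ac)
      finally show ?thesis using assms(2) by (simp add: field_simps)
    qed
    moreover have "\<exists>i\<in>?V. x $ (i - 1) \<noteq> 0"
    proof -
      obtain k where k: "k < n" "x $ k \<noteq> 0"
        using x(1,2) by (metis carrier_vecD eq_vecI index_zero_vec)
      then show ?thesis by (intro bexI[of _ "Suc k"]) auto
    qed
    ultimately have "\<mu> / lam \<in> {-1, 0, 1, 2}"
      by (intro spectrum[of "\<lambda>i. x $ (i - 1)"] ballI)
    then show ?thesis using assms(2) by (auto simp: field_simps)
  qed
  ultimately show ?thesis by blast
qed

end
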